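(* Let $I\subset\mathbb{N}$, $\overline J\subset\overline{\mathbb{N}}$ be nonempty finite sets with $\min(I\sqcup\overline J)\in I$ and $\max(I\sqcup\overline J)\in\overline J=:\{\dots,\overline j_{\max}\}$. Then the $h$-vector $(h_0,h_1,\dots)$ of the $(I,\overline J)$-Tamari complex satisfies, for every $\ell$, $$h_\ell=\#\{T\ \text{an }(I,\overline J)\text{-tree with exactly }\ell\text{ non-leaf nodes in }\overline J\setminus\{\overline j_{\max}\}\}=\#\{\nu(I,\overline J)\text{-Dyck paths with exactly }\ell\text{ valleys}\},$$ where a valley is an occurrence of $\mathsf E\mathsf N$ (a node is a leaf if it has degree $1$).
   Context: $\mathbb{N}=\{0,1,\dots\}$, $\overline{\mathbb{N}}$ a disjoint copy, totally ordered by $i\prec\overline i\prec i+1$. An $(I,\overline J)$-forest is a set of arcs $(i,\overline j)\in I\times\overline J$ with $i\le j$ for every arc and no two arcs $(i,\overline j),(i',\overline{j'})$ with $i<i'\le j<j'$; an $(I,\overline J)$-tree is a maximal one. The $(I,\overline J)$-Tamari complex is the simplicial complex on $\{(i,\overline j)\in I\times\overline J: i\le j\}$ whose faces are the $(I,\overline J)$-forests. $\nu(I,\overline J)$ is the lattice path (word in $\mathsf N,\mathsf E$) from $(0,0)$ to $(|I|-1,|\overline J|-1)$ whose $k$-th step is $\mathsf E$ if the $(k+1)$-st element of $I\sqcup\overline J$ (in $\prec$-order) lies in $I$ and $\mathsf N$ otherwise. A $\nu$-Dyck path is a lattice path with the same endpoint as $\nu$ lying weakly above $\nu$. *)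

theory Defs
  imports "HOL-Computational_Algebra.Polynomial"
begin

section \<open>Nodes: the naturals and their barred copy\<close>

datatype node = Plain nat | Barred nat

text \<open>The total order determined by \<open>Plain i < Barred i < Plain (i + 1)\<close>.\<close>

instantiation node :: linorder
begin

fun less_eq_node :: "node \<Rightarrow> node \<Rightarrow> bool" where
  "less_eq_node (Plain i) (Plain i') \<longleftrightarrow> i \<le> i'"
| "less_eq_node (Plain i) (Barred j) \<longleftrightarrow> i \<le> j"
| "less_eq_node (Barred j) (Plain i) \<longleftrightarrow> j < i"
| "less_eq_node (Barred j) (Barred j') \<longleftrightarrow> j \<le> j'"

definition less_node :: "node \<Rightarrow> node \<Rightarrow> bool" where
  "less_node v w \<longleftrightarrow> v \<le> w \<and> \<not> w \<le> v"

instance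
proof
  fix x y z :: node
  show "x < y \<longleftrightarrow> x \<le> y \<and> \<not> y \<le> x"
    by (rule less_node_def)
  show "x \<le> x"
    by (cases x) auto
  show "x \<le> y \<Longrightarrow> y \<le> z \<Longrightarrow> x \<le> z"
    by (cases x; cases y; cases z) auto
  show "x \<le> y \<Longrightarrow> y \<le> x \<Longrightarrow> x = y"
    by (cases x; cases y) auto
  show "x \<le> y \<or> y \<le> x"
    by (cases x; cases y) auto
qed

end

lemma Plain_less_Barred: "Plain i < Barred i" and Barred_less_Plain: "Barred i < Plain (i + 1)"
  by (simp_all add: less_node_def)

text \<open>The set \<open>J\<close> of naturals always stands for the set \<open>Barred ` J\<close> of barred naturals.\<close>

definition nodes :: "nat set \<Rightarrow> nat set \<Rightarrow> node set" where
  "nodes I J = Plain ` I \<union> Barred ` J"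

section \<open>Forests, trees and the Tamari complex\<close>

text \<open>The pair \<open>(i, j)\<close> encodes the arc from \<open>Plain i\<close> to \<open>Barred j\<close>.\<close>

definition arcs :: "nat set \<Rightarrow> nat set \<Rightarrow> (nat \<times> nat) set" where
  "arcs I J = {(i, j). i \<in> I \<and> j \<in> J \<and> i \<le> j}"

definition is_forest :: "nat set \<Rightarrow> nat set \<Rightarrow> (nat \<times> nat) set \<Rightarrow> bool" where
  "is_forest I J F \<longleftrightarrow>
     F \<subseteq> arcs I J \<and>
     \<not> (\<exists>i j i' j'. (i, j) \<in> F \<and> (i', j') \<in> F \<and> i < i' \<and> i' \<le> j \<and> j < j')"

definition is_tree :: "nat set \<Rightarrow> nat set \<Rightarrow> (nat \<times> nat) set \<Rightarrow> bool" where
  "is_tree I J T \<longleftrightarrow> is_forest I J T \<and> (\<forall>F. is_forest I J F \<and> T \<subseteq> F \<longrightarrow> F = T)"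

definition degree_of :: "(nat \<times> nat) set \<Rightarrow> node \<Rightarrow> nat" where
  "degree_of F v = card {(i, j). (i, j) \<in> F \<and> (v = Plain i \<or> v = Barred j)}"

definition is_leaf :: "(nat \<times> nat) set \<Rightarrow> node \<Rightarrow> bool" where
  "is_leaf F v \<longleftrightarrow> degree_of F v = 1"

text \<open>Abstract simplicial complexes are represented by their sets of faces.\<close>

definition tamari_complex :: "nat set \<Rightarrow> nat set \<Rightarrow> (nat \<times> nat) set set" where
  "tamari_complex I J = {F. is_forest I J F}"

lemma tamari_complex_faces:
  shows "{} \<in> tamari_complex I J"
    and "G \<in> tamari_complex I J \<Longrightarrow> F \<subseteq> G \<Longrightarrow> F \<in> tamari_complex I J"
    and "\<Union> (tamari_complex I J) = arcs I J"
proof -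
  have "is_forest I J {a}" if "a \<in> arcs I J" for a
    using that by (auto simp: is_forest_def)
  then show "\<Union> (tamari_complex I J) = arcs I J"
    by (auto simp: tamari_complex_def is_forest_def)
qed (unfold tamari_complex_def is_forest_def, blast+)

section \<open>The h-vector of a finite simplicial complex\<close>

text \<open>
  With \<open>f\<^sub>i\<^sub>-\<^sub>1\<close> the number of faces with \<open>i\<close> vertices (the empty face included) and \<open>d - 1\<close> the
  dimension of the complex, the h-vector is defined by
  \<open>(\<Sum>i. h\<^sub>i x\<^sup>i) = (\<Sum>i\<le>d. f\<^sub>i\<^sub>-\<^sub>1 x\<^sup>i (1 - x)\<^sup>d\<^sup>-\<^sup>i)\<close>,
  equivalently \<open>(\<Sum>i. h\<^sub>i x\<^sup>d\<^sup>-\<^sup>i) = (\<Sum>i\<le>d. f\<^sub>i\<^sub>-\<^sub>1 (x - 1)\<^sup>d\<^sup>-\<^sup>i)\<close>.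
\<close>

definition num_faces :: "'a set set \<Rightarrow> nat \<Rightarrow> nat" where
  "num_faces K i = card {\<sigma> \<in> K. card \<sigma> = i}"

definition h_poly :: "'a set set \<Rightarrow> int poly" where
  "h_poly K =
     (let d = Max (card ` K)
      in \<Sum>i\<le>d. of_nat (num_faces K i) * [:0, 1:] ^ i * [:1, -1:] ^ (d - i))"

definition h_vector :: "'a set set \<Rightarrow> nat \<Rightarrow> int" where
  "h_vector K l = coeff (h_poly K) l"

section \<open>Lattice paths\<close>

datatype step = North | East

type_synonym path = "step list"

definition endpoint :: "path \<Rightarrow> nat \<times> nat" where
  "endpoint p = (count_list p East, count_list p North)"

text \<open>The lattice points visited by a path starting at \<open>(0, 0)\<close>.\<close>

definition points :: "path \<Rightarrow> (nat \<times> nat) set" where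
  "points p = {endpoint (take k p) | k. k \<le> length p}"

text \<open>
  Lattice points suffice: on an East step both paths are horizontal between consecutive abscissae.
\<close>

definition weakly_above :: "path \<Rightarrow> path \<Rightarrow> bool" where
  "weakly_above p q \<longleftrightarrow> (\<forall>(x, y) \<in> points p. \<exists>y'. (x, y') \<in> points q \<and> y' \<le> y)"

text \<open>
  The index of the list is zero-based, so entry \<open>k\<close> is the \<open>(k + 1)\<close>-st element; here
  \<open>k\<close> runs through \<open>1, \<dots>, |I| + |J| - 2\<close>.
\<close>

definition nu :: "nat set \<Rightarrow> nat set \<Rightarrow> path" where
  "nu I J =
     map (\<lambda>k. if sorted_list_of_set (nodes I J) ! k \<in> Plain ` I then East else North)
       [1..<card I + card J - 1]"

definition dyck_paths :: "path \<Rightarrow> path set" where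
  "dyck_paths q = {p. endpoint p = endpoint q \<and> weakly_above p q}"

definition num_valleys :: "path \<Rightarrow> nat" where
  "num_valleys p = card {k. Suc k < length p \<and> p ! k = East \<and> p ! Suc k = North}"

end

theory Submission
  imports Defs
begin

text \<open>
  Let \<open>j\<close> be the least element of the second set. A forest either avoids \<open>j\<close>, or it is given by the
  least neighbour \<open>s\<close> of \<open>j\<close>, an arbitrary set \<open>U\<close> of further neighbours in \<open>I \<inter> {s<..j}\<close>, and a
  forest without \<open>j\<close> in which the elements of \<open>I \<inter> {s<..j}\<close> (now covered by the arc \<open>(s, j)\<close>) are
  removed; trees correspond to the full \<open>U\<close> and smaller trees. Removing the first North step of a
  Dyck path, together with the East steps before it, deletes the same data from \<open>\<nu>\<close>. Hence the
  h-polynomial, the generating polynomial of trees by non-leaves and the one of Dyck paths by valleys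
  obey the same recursion
  \<open>Q(I, J) = (\<Sum>s. (if s = m then 1 else x) * Q(I - {s<..j}, J - {j}))\<close>, where \<open>s\<close> runs through the
  elements of \<open>I\<close> up to \<open>j\<close> and \<open>m\<close> is the largest of them. For the h-polynomial, the sum over \<open>U\<close>
  collapses by the binomial theorem, and the forests avoiding \<open>j\<close> contribute \<open>1 - x\<close> times the term
  of \<open>m\<close>, turning its factor \<open>x\<close> into \<open>1\<close>.
\<close>

section \<open>Decomposition of forests at the least barred node\<close>

lemma finite_is_forest: "finite I \<Longrightarrow> finite J \<Longrightarrow> finite {F. is_forest I J F}"
  by (rule finite_subset[of _ "Pow (I \<times> J)"]) (auto simp: is_forest_def arcs_def)

lemma is_forest_finite: "is_forest I J F \<Longrightarrow> finite I \<Longrightarrow> finite J \<Longrightarrow> finite F"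
  by (rule finite_subset[of _ "I \<times> J"]) (auto simp: is_forest_def arcs_def)

lemma is_forest_snd: "is_forest I J F \<Longrightarrow> p \<in> F \<Longrightarrow> snd p \<in> J"
  by (auto simp: is_forest_def arcs_def)

text \<open>A crossing between the star at \<open>j\<close> and \<open>F\<close> would need an arc
  of \<open>F\<close> that starts in \<open>{s<..j}\<close> and ends beyond \<open>j\<close>, but
  those starting nodes have been removed. The opposite order cannot occur, since no arc of
  \<open>F\<close> ends before \<open>j\<close>.\<close>

lemma is_forest_join:
  assumes "\<forall>k\<in>J. j < k" "s \<in> I" "s \<le> j" "U \<subseteq> I \<inter> {s<..j}" "is_forest (I - {s<..j}) J F"
  shows "is_forest I (insert j J) (insert s U \<times> {j} \<union> F)"
proof -
  have F: "F \<subseteq> arcs (I - {s<..j}) J"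
    "\<And>i k i' k'. (i, k) \<in> F \<Longrightarrow> (i', k') \<in> F \<Longrightarrow> i < i' \<Longrightarrow> i' \<le> k \<Longrightarrow> k < k' \<Longrightarrow> False"
    using assms(5) unfolding is_forest_def by blast+
  have "F \<subseteq> arcs I (insert j J)"
    using F(1) by (auto simp: arcs_def)
  moreover have "insert s U \<times> {j} \<subseteq> arcs I (insert j J)"
    using assms(2-4) by (auto simp: arcs_def)
  moreover have False
    if a: "(i, k) \<in> insert s U \<times> {j} \<union> F" "(i', k') \<in> insert s U \<times> {j} \<union> F"
      and lt: "i < i'" "i' \<le> k" "k < k'" for i k i' k'
  proof (cases "(i', k') \<in> F")
    case True
    show False
    proof (cases "(i, k) \<in> F")
      case False
      then have "s < i'" "i' \<le> j"
        using a(1) lt assms(4) by auto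
      then show False
        using True F(1) by (auto simp: arcs_def)
    qed (use True F(2) lt in blast)
  next
    case False
    then have "k < j" using a(2) lt by auto
    then show False
      using a(1) F(1) assms(1) by (force simp: arcs_def)
  qed
  ultimately show ?thesis
    unfolding is_forest_def by (auto; blast)
qed

text \<open>Take \<open>s\<close> to be the least neighbour of \<open>j\<close>. The arc
  \<open>(s, j)\<close> forbids arcs from \<open>{s<..j}\<close> to any barred node beyond
  \<open>j\<close>, so the rest of the forest avoids these plain nodes.\<close>

lemma is_forest_split:
  assumes "\<forall>k\<in>J. j < k" "finite I" "is_forest I (insert j J) F"
  shows "is_forest I J F \<or>
    (\<exists>s U F'. s \<in> I \<inter> {..j} \<and> U \<subseteq> I \<inter> {s<..j} \<and> is_forest (I - {s<..j}) J F' \<and>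
      F = insert s U \<times> {j} \<union> F')"
proof (cases "\<exists>i. (i, j) \<in> F")
  case False
  then show ?thesis
    using assms unfolding is_forest_def arcs_def by fast
next
  case True
  define S where "S = {i. (i, j) \<in> F}"
  have SI: "S \<subseteq> I \<inter> {..j}"
    using assms(3) by (auto simp: S_def is_forest_def arcs_def)
  then have fin: "finite S"
    using assms(2) finite_subset by blast
  have ne: "S \<noteq> {}"
    using True by (auto simp: S_def)
  define s where "s = Min S"
  have s: "s \<in> S" "\<And>i. i \<in> S \<Longrightarrow> s \<le> i"
    using fin ne by (auto simp: s_def)
  define F' where "F' = {p \<in> F. snd p \<noteq> j}"
  have F: "F \<subseteq> arcs I (insert j J)"
    "\<And>i k i' k'. (i, k) \<in> F \<Longrightarrow> (i', k') \<in> F \<Longrightarrow> i < i' \<Longrightarrow> i' \<le> k \<Longrightarrow> k < k' \<Longrightarrow> False"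
    using assms(3) unfolding is_forest_def by blast+
  have "F' \<subseteq> arcs (I - {s<..j}) J"
  proof
    fix p assume p: "p \<in> F'"
    obtain i k where ik: "p = (i, k)" by fastforce
    have k: "(i, k) \<in> F" "i \<in> I" "k \<in> J" "i \<le> k" "j < k"
      using p ik F(1) assms(1) by (auto simp: F'_def arcs_def)
    have "\<not> (s < i \<and> i \<le> j)"
      using F(2)[of s j i k] s(1) k by (auto simp: S_def)
    then show "p \<in> arcs (I - {s<..j}) J"
      using ik k by (auto simp: arcs_def)
  qed
  then have "is_forest (I - {s<..j}) J F'"
    using F(2) unfolding is_forest_def F'_def by blast
  moreover have "F = insert s (S - {s}) \<times> {j} \<union> F'"
    using s(1) by (auto simp: S_def F'_def)
  moreover have "S - {s} \<subseteq> I \<inter> {s<..j}"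
    using SI s(2) by force
  ultimately show ?thesis
    using s(1) SI by blast
qed

lemma is_forest_mono: "is_forest I J F \<Longrightarrow> I \<subseteq> I' \<Longrightarrow> J \<subseteq> J' \<Longrightarrow> is_forest I' J' F"
  unfolding is_forest_def arcs_def by blast

text \<open>The decomposition is unique, hence a change of summation index. The summand
  \<open>g\<close> is arbitrary so that the face sum and the tree sum can share this lemma.\<close>

lemma sum_is_forest_insert:
  fixes g :: "(nat \<times> nat) set \<Rightarrow> 'a::comm_monoid_add"
  assumes j: "\<forall>k\<in>J. j < k" and fin: "finite I" "finite J"
  shows "(\<Sum>F | is_forest I (insert j J) F. g F) =
    (\<Sum>F | is_forest I J F. g F) +
    (\<Sum>s\<in>I \<inter> {..j}. \<Sum>U\<in>Pow (I \<inter> {s<..j}). \<Sum>F | is_forest (I - {s<..j}) J F.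
      g (insert s U \<times> {j} \<union> F))"
proof -
  let ?X = "SIGMA s:I \<inter> {..j}. SIGMA U:Pow (I \<inter> {s<..j}). {F. is_forest (I - {s<..j}) J F}"
  let ?f = "\<lambda>(s, U, F). insert s U \<times> {j} \<union> F :: (nat \<times> nat) set"
  have notin: "(i, j) \<notin> F" if "is_forest I' J F" for i I' F
    using that j by (auto simp: is_forest_def arcs_def)
  have un: "{F. is_forest I (insert j J) F} = {F. is_forest I J F} \<union> ?f ` ?X"
  proof (intro equalityI subsetI)
    fix F assume "F \<in> {F. is_forest I (insert j J) F}"
    then consider "is_forest I J F" | s U F' where "(s, U, F') \<in> ?X" "F = ?f (s, U, F')"
      using is_forest_split[OF j fin(1), of F] by auto
    then show "F \<in> {F. is_forest I J F} \<union> ?f ` ?X"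
      by cases blast+
  next
    fix F assume "F \<in> {F. is_forest I J F} \<union> ?f ` ?X"
    then show "F \<in> {F. is_forest I (insert j J) F}"
      using is_forest_join[OF j] is_forest_mono[of I J F I "insert j J"] by auto
  qed
  have disj: "{F. is_forest I J F} \<inter> ?f ` ?X = {}"
    using notin by fastforce
  have finX: "finite ?X"
    using fin by (intro finite_SigmaI) (auto intro: finite_is_forest)
  have inj: "inj_on ?f ?X"
  proof (rule inj_onI, clarsimp)
    fix s U F s' U' F'
    assume U: "s \<le> j" "U \<subseteq> I" "U \<subseteq> {s<..j}" "s' \<le> j" "U' \<subseteq> I" "U' \<subseteq> {s'<..j}"
      and F: "is_forest (I - {s<..j}) J F" "is_forest (I - {s'<..j}) J F'"
      and eq: "insert (s, j) (U \<times> {j} \<union> F) = insert (s', j) (U' \<times> {j} \<union> F')"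
    have "i \<in> insert s U \<longleftrightarrow> i \<in> insert s' U'" for i
      using arg_cong[OF eq, of "\<lambda>X. (i, j) \<in> X"] notin[OF F(1)] notin[OF F(2)] by auto
    then have ins: "insert s U = insert s' U'" by blast
    \<comment> \<open>Each of \<open>s\<close> and \<open>s'\<close> is the least element of the
      common neighbour set.\<close>
    have "s = s'"
      using ins U by (metis greaterThanAtMost_iff insert_iff less_asym subsetD)
    moreover have "s \<notin> U" "s' \<notin> U'" using U by auto
    moreover have "F = F'"
    proof (rule set_eqI)
      fix p :: "nat \<times> nat"
      show "p \<in> F \<longleftrightarrow> p \<in> F'"
        using arg_cong[OF eq, of "\<lambda>X. p \<in> X"] notin[OF F(1)] notin[OF F(2)]
        by (cases p) auto
    qed
    ultimately show "s = s' \<and> U = U' \<and> F = F'"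
      using ins by (auto dest: insert_ident)
  qed
  have "(\<Sum>F\<in>?f ` ?X. g F) = (\<Sum>x\<in>?X. g (?f x))"
    using sum.reindex[OF inj, of g] by (simp only: o_def)
  also have "\<dots> = (\<Sum>s\<in>I \<inter> {..j}. \<Sum>(U, F)\<in>Pow (I \<inter> {s<..j}) \<times> {F. is_forest (I - {s<..j}) J F}.
      g (insert s U \<times> {j} \<union> F))"
    using fin by (subst sum.Sigma) (auto simp: finite_is_forest case_prod_unfold)
  also have "\<dots> = (\<Sum>s\<in>I \<inter> {..j}. \<Sum>U\<in>Pow (I \<inter> {s<..j}). \<Sum>F | is_forest (I - {s<..j}) J F.
      g (insert s U \<times> {j} \<union> F))"
    by (simp only: sum.cartesian_product)
  finally have nested: "(\<Sum>F\<in>?f ` ?X. g F) = \<dots>" .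
  have "sum g {F. is_forest I (insert j J) F} = sum g {F. is_forest I J F} + sum g (?f ` ?X)"
    by (subst un, rule sum.union_disjoint[OF finite_is_forest[OF fin] finite_imageI[OF finX] disj])
  then show ?thesis
    by (simp only: nested)
qed

text \<open>For nonempty finite sets this says that the least node is plain and the greatest one is barred.\<close>

definition admissible :: "nat set \<Rightarrow> nat set \<Rightarrow> bool" where
  "admissible I J \<longleftrightarrow> finite I \<and> finite J \<and> I \<noteq> {} \<and> J \<noteq> {} \<and>
    (\<exists>i\<in>I. \<forall>j\<in>J. i \<le> j) \<and> (\<forall>i\<in>I. \<exists>j\<in>J. i \<le> j)"

text \<open>Keeps the recursion inside the admissible pairs: \<open>s\<close> survives the removal
  and lies below all of \<open>J\<close>, and a plain node bounded by \<open>j\<close> is also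
  bounded by any element of \<open>J\<close>.\<close>

lemma admissible_Diff:
  assumes "admissible I (insert j J)" "J \<noteq> {}" "\<forall>k\<in>J. j < k" "s \<in> I" "s \<le> j"
  shows "admissible (I - {s<..j}) J"
proof -
  have "\<forall>k\<in>J. s \<le> k"
    using assms(3,5) by (meson le_trans less_imp_le)
  moreover have "\<exists>k\<in>J. i \<le> k" if "i \<in> I" for i
  proof -
    obtain k where "k \<in> insert j J" "i \<le> k"
      using \<open>i \<in> I\<close> assms(1) by (auto simp: admissible_def)
    moreover obtain k' where "k' \<in> J" "j < k'"
      using assms(2,3) by blast
    ultimately show ?thesis
      by (cases "k = j") (auto intro: bexI[of _ k'])
  qed
  ultimately show ?thesis
    using assms by (auto simp: admissible_def)
qed

lemma card_Diff_greaterThanAtMost: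
  fixes I :: "nat set"
  assumes "finite I"
  shows "card I = card (I - {s<..j}) + card (I \<inter> {s<..j})"
proof -
  have "card ((I - {s<..j}) \<union> (I \<inter> {s<..j})) = card (I - {s<..j}) + card (I \<inter> {s<..j})"
    using assms by (intro card_Un_disjoint) auto
  then show ?thesis
    by (simp only: Un_Diff_Int)
qed

text \<open>For \<open>s = m\<close> nothing is removed, so the forests avoiding \<open>j\<close>
  live on the same pair as the term of \<open>m\<close>, and the only choice for \<open>U\<close> is
  the empty set.\<close>

lemma last_before:
  assumes "admissible I (insert j J)"
  defines "m \<equiv> Max (I \<inter> {..j})"
  shows "m \<in> I" "m \<le> j" "I \<inter> {m<..j} = {}" "I - {m<..j} = I"
proof -
  have fin: "finite (I \<inter> {..j})" and ne: "I \<inter> {..j} \<noteq> {}"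
    using assms by (auto simp: admissible_def)
  have "m \<in> I \<inter> {..j}"
    unfolding m_def using fin ne by (rule Max_in)
  then show "m \<in> I" "m \<le> j" by auto
  have "i \<le> m" if "i \<in> I" "i \<le> j" for i
    unfolding m_def using that fin by (intro Max_ge) auto
  then show "I \<inter> {m<..j} = {}" "I - {m<..j} = I"
    by force+
qed

section \<open>Purity of the complex\<close>

text \<open>Enlarge \<open>U\<close> to all of \<open>I \<inter> {s<..j}\<close> and extend the
  remaining forest by induction. The nodes gained as neighbours of \<open>j\<close> are exactly
  those removed from \<open>I\<close>, so the sizes add up independently of
  \<open>s\<close>.\<close>

lemma forest_extends_to_tree:
  assumes "finite J" "admissible I J" "is_forest I J F"
  shows "\<exists>T. F \<subseteq> T \<and> is_forest I J T \<and> card T = card I + card J - 1"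
  using assms
proof (induction J arbitrary: I F rule: finite_linorder_min_induct)
  case (insert j J)
  have finI: "finite I" using insert.prems by (simp add: admissible_def)
  show ?case
  proof (cases "J = {}")
    \<comment> \<open>The true base case: admissibility excludes an empty set of barred nodes, and
      the forests here lie in the star at \<open>j\<close>.\<close>
    case True
    have "is_forest I {j} (I \<times> {j})"
      using insert.prems(1) True by (auto simp: is_forest_def arcs_def admissible_def)
    moreover have "F \<subseteq> I \<times> {j}"
      using insert.prems(2) True by (auto simp: is_forest_def arcs_def)
    moreover have "card (I \<times> {j}) = card I + card (insert j J) - 1"
      using True by (simp add: card_cartesian_product)
    ultimately show ?thesis
      using True by blast
  next
    case False
    have step: "\<exists>T. insert s U \<times> {j} \<union> F' \<subseteq> T \<and> is_forest I (insert j J) T \<and>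
        card T = card I + card (insert j J) - 1"
      if s: "s \<in> I \<inter> {..j}" "U \<subseteq> I \<inter> {s<..j}" "is_forest (I - {s<..j}) J F'" for s U F'
    proof -
      let ?I = "I - {s<..j}" and ?U = "I \<inter> {s<..j}"
      have adm: "admissible ?I J"
        using admissible_Diff[OF insert.prems(1) False insert.hyps(2)] s(1) by simp
      obtain T where T: "F' \<subseteq> T" "is_forest ?I J T" "card T = card ?I + card J - 1"
        using insert.IH[OF adm s(3)] by blast
      have "(insert s ?U \<times> {j}) \<inter> T = {}"
        using is_forest_snd[OF T(2)] insert.hyps(2) by fastforce
      then have "card (insert s ?U \<times> {j} \<union> T) = card (insert s ?U \<times> {j}) + card T"
        using finI insert.hyps(1) is_forest_finite[OF T(2)] by (simp add: card_Un_disjoint)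
      moreover have "card I = card ?I + card ?U"
        using finI by (rule card_Diff_greaterThanAtMost)
      moreover have "card ?I > 0" "card J > 0"
        using adm by (auto simp: card_gt_0_iff admissible_def)
      moreover have "j \<notin> J" using insert.hyps(2) by auto
      ultimately have "card (insert s ?U \<times> {j} \<union> T) = card I + card (insert j J) - 1"
        using T(3) insert.hyps(1) finI by (simp add: card_cartesian_product)
      moreover have "is_forest I (insert j J) (insert s ?U \<times> {j} \<union> T)"
        using is_forest_join[OF insert.hyps(2) _ _ order_refl T(2)] s(1) by simp
      moreover have "insert s U \<times> {j} \<union> F' \<subseteq> insert s ?U \<times> {j} \<union> T"
        using T(1) s(2) by auto
      ultimately show ?thesis by blast
    qed
    consider "is_forest I J F"
      | s U F' where "s \<in> I \<inter> {..j}" "U \<subseteq> I \<inter> {s<..j}" "is_forest (I - {s<..j}) J F'"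
        "F = insert s U \<times> {j} \<union> F'"
      using is_forest_split[OF insert.hyps(2) finI insert.prems(2)] by blast
    then show ?thesis
    proof cases
      case 1
      \<comment> \<open>A forest avoiding \<open>j\<close> gains the arc from the last plain node
        before \<open>j\<close>; this choice removes no plain node.\<close>
      let ?s = "Max (I \<inter> {..j})"
      show ?thesis
        using step[of ?s "{}" F] 1 last_before[OF insert.prems(1)] by force
    next
      case 2
      then show ?thesis
        using step[OF 2(1-3)] by (simp only:)
    qed
  qed
qed (simp add: admissible_def)

lemma admissible_finite:
  assumes "admissible I J"
  shows "finite I" "finite J"
  using assms by (auto simp: admissible_def)

lemma is_forest_card_le:
  assumes "admissible I J" "is_forest I J F"
  shows "card F \<le> card I + card J - 1"
proof -
  obtain T where "F \<subseteq> T" "is_forest I J T" "card T = card I + card J - 1"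
    using forest_extends_to_tree[OF admissible_finite(2)[OF assms(1)] assms] by blast
  then show ?thesis
    using card_mono[of T F] is_forest_finite[of I J T] admissible_finite[OF assms(1)] by simp
qed

text \<open>By purity a maximal forest coincides with its full-size extension, and a forest of the
  largest possible size cannot grow. Maximality thus becomes a size condition.\<close>

lemma is_tree_iff_card:
  assumes "admissible I J"
  shows "is_tree I J T \<longleftrightarrow> is_forest I J T \<and> card T = card I + card J - 1"
proof
  assume "is_tree I J T"
  then show "is_forest I J T \<and> card T = card I + card J - 1"
    using forest_extends_to_tree[OF _ assms, of T] admissible_finite[OF assms]
    by (auto simp: is_tree_def)
next
  assume T: "is_forest I J T \<and> card T = card I + card J - 1"
  have "F = T" if "is_forest I J F" "T \<subseteq> F" for F
    using that T is_forest_card_le[OF assms that(1)] is_forest_finite[OF that(1)]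
      admissible_finite[OF assms] by (metis card_seteq)
  then show "is_tree I J T"
    using T by (simp add: is_tree_def)
qed

text \<open>Evaluates the number \<open>d\<close> of \<open>h_poly\<close>: extending the empty
  forest attains the bound.\<close>

lemma Max_card_tamari_complex:
  assumes "admissible I J"
  shows "Max (card ` tamari_complex I J) = card I + card J - 1"
proof (rule Max_eqI)
  show "finite (card ` tamari_complex I J)"
    using admissible_finite[OF assms] by (simp add: tamari_complex_def finite_is_forest)
  have "is_forest I J {}" by (simp add: is_forest_def)
  then obtain T where "is_forest I J T" "card T = card I + card J - 1"
    using forest_extends_to_tree[OF _ assms] admissible_finite[OF assms] by blast
  then show "card I + card J - 1 \<in> card ` tamari_complex I J"
    unfolding tamari_complex_def by (intro image_eqI[of _ card T]) simp_all
  show "n \<le> card I + card J - 1" if "n \<in> card ` tamari_complex I J" for n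
    using that is_forest_card_le[OF assms] unfolding tamari_complex_def by blast
qed

section \<open>Generating functions of forests and trees\<close>

text \<open>The tree statistic on numbers instead of nodes; \<open>card_nonleaf_nodes\<close> proves
  the agreement.\<close>

definition nonleaves :: "nat set \<Rightarrow> (nat \<times> nat) set \<Rightarrow> nat" where
  "nonleaves J F = card {j \<in> J - {Max J}. card {i. (i, j) \<in> F} \<noteq> 1}"

text \<open>The h-polynomial at \<open>x\<close> for admissible pairs, where
  \<open>card I + card J - 1\<close> is one more than the dimension.\<close>

definition face_sum :: "'a::comm_ring_1 \<Rightarrow> nat set \<Rightarrow> nat set \<Rightarrow> 'a" where
  "face_sum x I J =
    (\<Sum>F | is_forest I J F. x ^ card F * (1 - x) ^ (card I + card J - 1 - card F))"

text \<open>Trees are selected by size among all forests, so that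
  \<open>sum_is_forest_insert\<close> applies.\<close>

definition tree_sum :: "'a::comm_ring_1 \<Rightarrow> nat set \<Rightarrow> nat set \<Rightarrow> 'a" where
  "tree_sum x I J =
    (\<Sum>F | is_forest I J F. if card F = card I + card J - 1 then x ^ nonleaves J F else 0)"

text \<open>The expansion of the product of \<open>x + (1 - x)\<close> over \<open>B\<close>, in
  which \<open>U\<close> records the factors contributing \<open>x\<close>.\<close>

lemma sum_Pow_power:
  fixes x :: "'a::comm_ring_1"
  assumes "finite B"
  shows "(\<Sum>U\<in>Pow B. x ^ card U * (1 - x) ^ (card B - card U)) = 1"
proof -
  have "(\<Sum>U\<in>Pow B. x ^ card U * (1 - x) ^ (card B - card U)) =
      (\<Sum>U\<in>Pow B. (\<Prod>b\<in>U. x) * (\<Prod>b\<in>B - U. 1 - x))"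
    by (rule sum.cong) (auto simp: card_Diff_subset finite_subset[OF _ assms])
  also have "\<dots> = (\<Prod>b\<in>B. x + (1 - x))"
    using prod_add[OF assms, of "\<lambda>_. x" "\<lambda>_. 1 - x"] by (simp only:)
  finally show ?thesis by simp
qed

context
  fixes I J :: "nat set" and j :: nat
  assumes adm: "admissible I (insert j J)" and less: "\<forall>k\<in>J. j < k"
begin

lemma finite_insert: "finite I" "finite J"
  using adm by (auto simp: admissible_def)

lemma card_insert_least: "card (insert j J) = Suc (card J)"
  using less finite_insert by (metis card_insert_disjoint less_irrefl)

lemma card_join:
  assumes "s \<in> I" "s \<le> j" "U \<subseteq> I \<inter> {s<..j}" "is_forest (I - {s<..j}) J F"
  shows "card (insert s U \<times> {j} \<union> F) = Suc (card U + card F)"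
proof -
  have "finite U" "s \<notin> U"
    using assms(3) finite_insert finite_subset by auto
  moreover have "insert s U \<times> {j} \<inter> F = {}"
    using is_forest_snd[OF assms(4)] less by fastforce
  moreover have "finite F"
    using is_forest_finite[OF assms(4)] finite_insert by simp
  ultimately show ?thesis
    by (simp add: card_Un_disjoint card_cartesian_product del: Un_insert_left insert_Times_insert)
qed

text \<open>Avoiding \<open>j\<close> costs at least one arc compared with a tree on
  \<open>insert j J\<close>: such a forest is bounded by the size of trees on the smaller
  pair.\<close>

lemma is_forest_card_less:
  assumes "is_forest I J F" "J \<noteq> {}"
  shows "card F < card I + card J"
proof -
  have "admissible I J"
    using admissible_Diff[OF adm assms(2) less] last_before[OF adm] by metis
  then have "card F \<le> card I + card J - 1"
    using assms(1) by (rule is_forest_card_le)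
  moreover have "card J > 0"
    using assms(2) finite_insert by (simp add: card_gt_0_iff)
  ultimately show ?thesis by linarith
qed

lemma face_sum_insert:
  fixes x :: "'a::comm_ring_1"
  assumes "J \<noteq> {}"
  shows "face_sum x I (insert j J) =
    (\<Sum>s\<in>I \<inter> {..j}. (if s = Max (I \<inter> {..j}) then 1 else x) * face_sum x (I - {s<..j}) J)"
proof -
  let ?m = "Max (I \<inter> {..j})"
  let ?w = "\<lambda>F. x ^ card F * (1 - x) ^ (card I + card (insert j J) - 1 - card F)"
  have m: "?m \<in> I \<inter> {..j}" "I - {?m<..j} = I"
    using last_before[OF adm] by auto
  \<comment> \<open>The maximal size exceeds that for \<open>J\<close> by one, which leaves a spare
    factor \<open>1 - x\<close>.\<close>
  have "?w F = (1 - x) * (x ^ card F * (1 - x) ^ (card I + card J - 1 - card F))"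
    if "is_forest I J F" for F
  proof -
    have "card I + card (insert j J) - 1 - card F = Suc (card I + card J - 1 - card F)"
      using is_forest_card_less[OF that assms] by (simp add: card_insert_least)
    then show ?thesis by (simp only: power_Suc mult_ac)
  qed
  then have empty: "(\<Sum>F | is_forest I J F. ?w F) = (1 - x) * face_sum x I J"
    by (simp add: face_sum_def sum_distrib_left)
  have join: "(\<Sum>U\<in>Pow (I \<inter> {s<..j}). \<Sum>F | is_forest (I - {s<..j}) J F. ?w (insert s U \<times> {j} \<union> F)) =
      x * face_sum x (I - {s<..j}) J" if s: "s \<in> I \<inter> {..j}" for s
  proof -
    let ?I = "I - {s<..j}" and ?B = "I \<inter> {s<..j}"
    have adm': "admissible ?I J"
      using admissible_Diff[OF adm assms less] s by simp
    then have pos: "card J > 0" "card ?I > 0"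
      by (auto simp: admissible_def card_gt_0_iff)
    have "?w (insert s U \<times> {j} \<union> F) = x * ((x ^ card U * (1 - x) ^ (card ?B - card U)) *
        (x ^ card F * (1 - x) ^ (card ?I + card J - 1 - card F)))"
      if "U \<in> Pow ?B" "is_forest ?I J F" for U F
    proof -
      have U: "card (insert s U \<times> {j} \<union> F) = Suc (card U + card F)"
        using card_join that s by simp
      have "card U \<le> card ?B"
        using that finite_insert by (intro card_mono) auto
      moreover have "card F \<le> card ?I + card J - 1"
        using is_forest_card_le[OF adm' that(2)] .
      \<comment> \<open>The missing arcs split into those missing at \<open>j\<close> and those
        missing in \<open>F\<close>; the bounds on both sizes make the truncated subtractions
        exact.\<close>
      ultimately have "card I + card (insert j J) - 1 - Suc (card U + card F) =
          (card ?B - card U) + (card ?I + card J - 1 - card F)"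
        using card_Diff_greaterThanAtMost[of I s j] finite_insert pos
        by (simp add: card_insert_least)
      then show ?thesis
        unfolding U by (simp only: power_add power_Suc mult_ac)
    qed
    then have "(\<Sum>U\<in>Pow ?B. \<Sum>F | is_forest ?I J F. ?w (insert s U \<times> {j} \<union> F)) =
        (\<Sum>U\<in>Pow ?B. \<Sum>F | is_forest ?I J F. x * ((x ^ card U * (1 - x) ^ (card ?B - card U)) *
          (x ^ card F * (1 - x) ^ (card ?I + card J - 1 - card F))))"
      by (intro sum.cong refl) auto
    also have "\<dots> = x * ((\<Sum>U\<in>Pow ?B. x ^ card U * (1 - x) ^ (card ?B - card U)) * face_sum x ?I J)"
      unfolding face_sum_def sum_product by (simp only: sum_distrib_left)
    finally show ?thesis
      using sum_Pow_power[of ?B x] finite_insert by simp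
  qed
  have "face_sum x I (insert j J) =
      (1 - x) * face_sum x I J + (\<Sum>s\<in>I \<inter> {..j}. x * face_sum x (I - {s<..j}) J)"
    unfolding face_sum_def[of x I "insert j J"] sum_is_forest_insert[OF less finite_insert] empty
    by (simp only: join cong: sum.cong)
  \<comment> \<open>The term of \<open>m\<close> is \<open>x * face_sum x I J\<close>; together with
    the forests avoiding \<open>j\<close> it has total coefficient
    \<open>(1 - x) + x = 1\<close>.\<close>
  also have "\<dots> = face_sum x I J + (\<Sum>s\<in>I \<inter> {..j} - {?m}. x * face_sum x (I - {s<..j}) J)"
    using m finite_insert by (subst sum.remove[of _ ?m]) (auto simp: algebra_simps)
  also have "\<dots> = (\<Sum>s\<in>I \<inter> {..j}. (if s = ?m then 1 else x) * face_sum x (I - {s<..j}) J)"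
    using m finite_insert by (subst (2) sum.remove[of _ ?m]) auto
  finally show ?thesis .
qed

text \<open>The degree of \<open>j\<close> is \<open>1 + card U\<close>, and the other barred nodes
  keep their degrees. As \<open>J\<close> is nonempty, the exempt greatest node is the same before
  and after inserting \<open>j\<close>.\<close>

lemma nonleaves_join:
  assumes "J \<noteq> {}" "s \<in> I" "s \<le> j" "U \<subseteq> I \<inter> {s<..j}" "is_forest (I - {s<..j}) J F"
  shows "nonleaves (insert j J) (insert s U \<times> {j} \<union> F) = (if U = {} then 0 else 1) + nonleaves J F"
proof -
  let ?G = "insert s U \<times> {j} \<union> F"
  let ?N = "{k \<in> J - {Max J}. card {i. (i, k) \<in> F} \<noteq> 1}"
  have finU: "finite U" "s \<notin> U"
    using assms(4) finite_insert finite_subset by auto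
  have Max: "Max J \<in> J" using assms(1) finite_insert by simp
  then have "j < Max J" using less by blast
  then have MaxJ: "Max (insert j J) = Max J" "j \<noteq> Max J"
    using assms(1) finite_insert by auto
  have j: "{i. (i, j) \<in> ?G} = insert s U"
    using is_forest_snd[OF assms(5)] less by fastforce
  have k: "{i. (i, k) \<in> ?G} = {i. (i, k) \<in> F}" "k \<noteq> j" if "k \<in> J" for k
    using that less by auto
  have "card (insert s U) \<noteq> 1 \<longleftrightarrow> U \<noteq> {}"
    using finU by simp
  then have "{k \<in> insert j J - {Max (insert j J)}. card {i. (i, k) \<in> ?G} \<noteq> 1} =
      (if U = {} then {} else {j}) \<union> ?N"
    unfolding MaxJ using j k MaxJ(2) by (auto simp del: Un_insert_left)
  moreover have "card ((if U = {} then {} else {j}) \<union> ?N) = (if U = {} then 0 else 1) + card ?N"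
  proof -
    have "finite ?N" "j \<notin> ?N"
      using finite_insert less by auto
    then show ?thesis by simp
  qed
  ultimately show ?thesis
    by (simp only: nonleaves_def)
qed

lemma tree_sum_insert:
  fixes x :: "'a::comm_ring_1"
  assumes "J \<noteq> {}"
  shows "tree_sum x I (insert j J) =
    (\<Sum>s\<in>I \<inter> {..j}. (if s = Max (I \<inter> {..j}) then 1 else x) * tree_sum x (I - {s<..j}) J)"
proof -
  let ?m = "Max (I \<inter> {..j})"
  let ?w = "\<lambda>F. if card F = card I + card (insert j J) - 1 then x ^ nonleaves (insert j J) F else 0"
  have m: "?m \<in> I \<inter> {..j}" "I \<inter> {?m<..j} = {}"
    using last_before[OF adm] by auto
  \<comment> \<open>Forests avoiding \<open>j\<close> are too small to be trees.\<close>
  have "?w F = 0" if "is_forest I J F" for F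
    using is_forest_card_less[OF that assms] by (simp add: card_insert_least)
  then have empty: "(\<Sum>F | is_forest I J F. ?w F) = 0"
    by simp
  have join: "(\<Sum>U\<in>Pow (I \<inter> {s<..j}). \<Sum>F | is_forest (I - {s<..j}) J F. ?w (insert s U \<times> {j} \<union> F)) =
      (if s = ?m then 1 else x) * tree_sum x (I - {s<..j}) J" if s: "s \<in> I \<inter> {..j}" for s
  proof -
    let ?I = "I - {s<..j}" and ?B = "I \<inter> {s<..j}"
    have adm': "admissible ?I J"
      using admissible_Diff[OF adm assms less] s by simp
    then have pos: "card J > 0" "card ?I > 0"
      by (auto simp: admissible_def card_gt_0_iff)
    have card: "card I + card (insert j J) - 1 = Suc (card ?B + (card ?I + card J - 1))"
      using card_Diff_greaterThanAtMost[of I s j] finite_insert pos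
      by (simp add: card_insert_least)
    \<comment> \<open>A proper subset \<open>U\<close> leaves too few arcs, whatever
      \<open>F\<close> is.\<close>
    have "?w (insert s U \<times> {j} \<union> F) = 0"
      if "U \<in> Pow ?B - {?B}" "is_forest ?I J F" for U F
    proof -
      have "card U < card ?B"
        using that finite_insert by (intro psubset_card_mono) auto
      then show ?thesis
        using card_join[of s U F] that s is_forest_card_le[OF adm' that(2)] card
        by (simp del: Un_insert_left insert_Times_insert)
    qed
    then have "(\<Sum>U\<in>Pow ?B. \<Sum>F | is_forest ?I J F. ?w (insert s U \<times> {j} \<union> F)) =
        (\<Sum>F | is_forest ?I J F. ?w (insert s ?B \<times> {j} \<union> F))"
      using finite_insert by (subst sum.remove[of _ ?B])
        (simp_all del: Un_insert_left insert_Times_insert)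
    also have "\<dots> = (\<Sum>F | is_forest ?I J F. (if s = ?m then 1 else x) *
        (if card F = card ?I + card J - 1 then x ^ nonleaves J F else 0))"
    proof (rule sum.cong[OF refl])
      fix F assume "F \<in> {F. is_forest ?I J F}"
      then have F: "is_forest ?I J F" by simp
      have "s \<le> ?m"
        using s finite_insert by (intro Max_ge) auto
      \<comment> \<open>So \<open>j\<close> is a leaf exactly for \<open>s = m\<close>, which
        accounts for the weight \<open>1\<close> there and \<open>x\<close> elsewhere.\<close>
      then have "?B = {} \<longleftrightarrow> s = ?m"
        using m by (auto dest: le_neq_implies_less)
      then show "?w (insert s ?B \<times> {j} \<union> F) = (if s = ?m then 1 else x) *
          (if card F = card ?I + card J - 1 then x ^ nonleaves J F else 0)"
        using card_join[OF _ _ order_refl F] nonleaves_join[OF assms _ _ order_refl F] s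
        unfolding card by (simp del: Un_insert_left insert_Times_insert)
    qed
    finally show ?thesis
      by (simp only: tree_sum_def sum_distrib_left)
  qed
  show ?thesis
    unfolding tree_sum_def[of x I "insert j J"] sum_is_forest_insert[OF less finite_insert] empty
    by (simp only: join add_0 cong: sum.cong)
qed

end

section \<open>The case of a single barred node\<close>

text \<open>A crossing needs two barred nodes, and admissibility makes every plain node a possible
  neighbour of \<open>j\<close>; the complex is a full simplex.\<close>

lemma Collect_is_forest_singleton:
  assumes "admissible I {j}"
  shows "{F. is_forest I {j} F} = (\<lambda>S. S \<times> {j}) ` Pow I"
proof (intro equalityI subsetI)
  fix F assume "F \<in> {F. is_forest I {j} F}"
  then have "F = fst ` F \<times> {j}" "fst ` F \<subseteq> I"
    by (auto simp: is_forest_def arcs_def image_iff) force+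
  then show "F \<in> (\<lambda>S. S \<times> {j}) ` Pow I"
    by blast
next
  fix F assume "F \<in> (\<lambda>S. S \<times> {j}) ` Pow I"
  then show "F \<in> {F. is_forest I {j} F}"
    using assms by (auto simp: is_forest_def arcs_def admissible_def)
qed

lemma sum_is_forest_singleton:
  assumes "admissible I {j}"
  shows "(\<Sum>F | is_forest I {j} F. g F) = (\<Sum>S\<in>Pow I. g (S \<times> {j}))"
proof -
  have "inj_on (\<lambda>S. S \<times> {j}) (Pow I)"
    by (rule inj_onI) blast
  then show ?thesis
    unfolding Collect_is_forest_singleton[OF assms] by (simp add: sum.reindex)
qed

lemma face_sum_singleton:
  assumes "admissible I {j}"
  shows "face_sum x I {j} = (1::'a::comm_ring_1)"
proof -
  have "face_sum x I {j} = (\<Sum>S\<in>Pow I. x ^ card S * (1 - x) ^ (card I - card S))"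
    unfolding face_sum_def sum_is_forest_singleton[OF assms]
    by (simp add: card_cartesian_product)
  then show ?thesis
    using assms by (simp add: sum_Pow_power admissible_def)
qed

text \<open>The only tree is the full star, and its barred node is the exempt maximum.\<close>

lemma tree_sum_singleton:
  assumes "admissible I {j}"
  shows "tree_sum x I {j} = (1::'a::comm_ring_1)"
proof -
  have fin: "finite I" using assms by (simp add: admissible_def)
  have "nonleaves {j} F = 0" for F
    by (simp add: nonleaves_def)
  then have "tree_sum x I {j} = (\<Sum>S\<in>Pow I. if S = I then 1 else (0::'a))"
    unfolding tree_sum_def sum_is_forest_singleton[OF assms]
    using fin by (intro sum.cong) (auto simp: card_cartesian_product dest: card_subset_eq)
  then show ?thesis using fin by simp
qed

section \<open>Dyck paths\<close>

lemma endpoint_Cons: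
  "endpoint (East # p) = (Suc (fst (endpoint p)), snd (endpoint p))"
  "endpoint (North # p) = (fst (endpoint p), Suc (snd (endpoint p)))"
  by (simp_all add: endpoint_def)

lemma points_Nil [simp]: "points [] = {(0, 0)}"
  by (simp add: points_def endpoint_def)

lemma points_eq_image: "points p = (\<lambda>k. endpoint (take k p)) ` {..length p}"
  by (auto simp: points_def)

lemma points_Cons:
  "points (a # p) = insert (0, 0)
    ((\<lambda>(x, y). case a of East \<Rightarrow> (Suc x, y) | North \<Rightarrow> (x, Suc y)) ` points p)"
proof -
  let ?f = "\<lambda>(x, y). case a of East \<Rightarrow> (Suc x, y) | North \<Rightarrow> (x, Suc y)"
  have f: "endpoint (a # q) = ?f (endpoint q)" for q
    by (cases a) (simp_all add: endpoint_Cons split_beta)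
  have "points (a # p) = insert (endpoint []) ((\<lambda>k. endpoint (a # take k p)) ` {..length p})"
    by (simp only: points_eq_image list.size add_Suc_right add_0_right atMost_Suc_eq_insert_0
        image_insert image_image take_0 take_Suc_Cons)
  then show ?thesis
    unfolding f points_eq_image[of p] image_image by (simp add: endpoint_def)
qed

lemma points_Cons_iff:
  "(x, y) \<in> points (East # p) \<longleftrightarrow> x = 0 \<and> y = 0 \<or> 0 < x \<and> (x - 1, y) \<in> points p"
  "(x, y) \<in> points (North # p) \<longleftrightarrow> x = 0 \<and> y = 0 \<or> 0 < y \<and> (x, y - 1) \<in> points p"
proof -
  show "(x, y) \<in> points (East # p) \<longleftrightarrow> x = 0 \<and> y = 0 \<or> 0 < x \<and> (x - 1, y) \<in> points p"
    unfolding points_Cons by (cases x) force+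
  show "(x, y) \<in> points (North # p) \<longleftrightarrow> x = 0 \<and> y = 0 \<or> 0 < y \<and> (x, y - 1) \<in> points p"
    unfolding points_Cons by (cases y) force+
qed

lemma origin_in_points: "(0, 0) \<in> points p"
  by (cases p) (simp_all add: points_Cons)

lemma points_replicate_East:
  "(x, y) \<in> points (replicate n East @ p) \<longleftrightarrow>
    x < n \<and> y = 0 \<or> n \<le> x \<and> (x - n, y) \<in> points p"
proof (induction n arbitrary: x)
  case (Suc n)
  then show ?case
    by (cases x) (auto simp: points_Cons_iff)
qed simp

text \<open>The upper path must leave height zero no later than the lower one. Deleting the bottom
  row and moving the origin to abscissa \<open>r\<close> leaves \<open>n - r\<close> East steps in
  front of \<open>q\<close>.\<close>

lemma weakly_above_first_North:
  "weakly_above (replicate r East @ North # p) (replicate n East @ North # q) \<longleftrightarrow>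
    r \<le> n \<and> weakly_above p (replicate (n - r) East @ q)"
proof -
  let ?P = "replicate r East @ North # p" and ?Q = "replicate n East @ North # q"
  have P: "(x, y) \<in> points ?P \<longleftrightarrow> x \<le> r \<and> y = 0 \<or> r \<le> x \<and> 0 < y \<and> (x - r, y - 1) \<in> points p"
    for x y unfolding points_replicate_East points_Cons_iff by auto
  have Q: "(x, y) \<in> points ?Q \<longleftrightarrow> x \<le> n \<and> y = 0 \<or> n \<le> x \<and> 0 < y \<and> (x - n, y - 1) \<in> points q"
    for x y unfolding points_replicate_East points_Cons_iff by auto
  have above: "(\<exists>y'. (r + x, y') \<in> points ?Q \<and> y' \<le> Suc y) \<longleftrightarrow>
      (\<exists>y'. (x, y') \<in> points (replicate (n - r) East @ q) \<and> y' \<le> y)" if "r \<le> n" for x y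
  proof (cases "r + x \<le> n")
    \<comment> \<open>Up to abscissa \<open>n\<close> the lower path has a point at height zero,
      both before and after the deletion, so both sides hold.\<close>
    case True
    have "(x, 0) \<in> points (replicate (n - r) East @ q)"
      using True that origin_in_points[of q] by (auto simp: points_replicate_East)
    then show ?thesis
      using True by (auto simp: Q intro: exI[of _ 0])
  next
    case False
    have "(\<exists>y'. (r + x, y') \<in> points ?Q \<and> y' \<le> Suc y) \<longleftrightarrow>
        (\<exists>y'. 0 < y' \<and> (r + x - n, y' - 1) \<in> points q \<and> y' \<le> Suc y)"
      using False by (auto simp: Q)
    also have "\<dots> \<longleftrightarrow> (\<exists>y'. (r + x - n, y') \<in> points q \<and> y' \<le> y)"
      by (metis Suc_le_mono Suc_pred diff_Suc_1 zero_less_Suc)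
    also have "r + x - n = x - (n - r)" using that by simp
    finally show ?thesis
      using False that by (auto simp: points_replicate_East)
  qed
  show ?thesis
  proof
    assume w: "weakly_above ?P ?Q"
    have "(r, 0) \<in> points ?P" by (simp add: P)
    then obtain y' where "(r, y') \<in> points ?Q" "y' \<le> 0"
      using w unfolding weakly_above_def by blast
    then have r: "r \<le> n" by (auto simp: Q)
    have "\<exists>y'. (x, y') \<in> points (replicate (n - r) East @ q) \<and> y' \<le> y" if "(x, y) \<in> points p" for x y
    proof -
      have "(r + x, Suc y) \<in> points ?P" using that by (simp add: P)
      then have "\<exists>y'. (r + x, y') \<in> points ?Q \<and> y' \<le> Suc y"
        using w unfolding weakly_above_def by blast
      then show ?thesis
        by (simp only: above[OF r])
    qed
    then show "r \<le> n \<and> weakly_above p (replicate (n - r) East @ q)"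
      using r by (auto simp: weakly_above_def)
  next
    assume w: "r \<le> n \<and> weakly_above p (replicate (n - r) East @ q)"
    have "\<exists>y'. (x, y') \<in> points ?Q \<and> y' \<le> y" if "(x, y) \<in> points ?P" for x y
    proof (cases "y = 0")
      case True
      then have "(x, 0) \<in> points ?Q"
        using that w by (simp add: P Q)
      then show ?thesis by blast
    next
      case False
      then have "(x - r, y - 1) \<in> points p" "r \<le> x" using that by (auto simp: P)
      then have "\<exists>y'. (x - r, y') \<in> points (replicate (n - r) East @ q) \<and> y' \<le> y - 1"
        using w unfolding weakly_above_def by blast
      then show ?thesis
        using above[of "x - r" "y - 1"] w \<open>r \<le> x\<close> False by simp
    qed
    then show "weakly_above ?P ?Q" by (auto simp: weakly_above_def)
  qed
qed

lemma num_valleys_Nil [simp]: "num_valleys [] = 0"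
  by (simp add: num_valleys_def)

lemma num_valleys_Cons:
  "num_valleys (a # p) = (if a = East \<and> p \<noteq> [] \<and> hd p = North then 1 else 0) + num_valleys p"
proof -
  let ?V = "\<lambda>p. {k. Suc k < length p \<and> p ! k = East \<and> p ! Suc k = North}"
  let ?Z = "if a = East \<and> p \<noteq> [] \<and> hd p = North then {0::nat} else {}"
  have "k \<in> ?V (a # p) \<longleftrightarrow> k \<in> ?Z \<union> Suc ` ?V p" for k
    by (cases k) (auto simp: hd_conv_nth)
  then have "?V (a # p) = ?Z \<union> Suc ` ?V p"
    by blast
  moreover have "card (?Z \<union> Suc ` ?V p) = card ?Z + card (Suc ` ?V p)"
    by (intro card_Un_disjoint) (auto intro: finite_subset[of _ "{..<length p}"])
  moreover have "card (Suc ` ?V p) = card (?V p)"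
    by (simp add: card_image)
  ultimately show ?thesis
    by (simp add: num_valleys_def)
qed

text \<open>The first North step closes a valley exactly when an East step precedes it.\<close>

lemma num_valleys_first_North:
  "num_valleys (replicate r East @ North # p) = (if r = 0 then 0 else 1) + num_valleys p"
proof (induction r)
  case (Suc r)
  then show ?case by (cases r) (simp_all add: num_valleys_Cons)
qed (simp add: num_valleys_Cons)

lemma length_eq_endpoint: "length p = fst (endpoint p) + snd (endpoint p)"
proof (induction p)
  case (Cons a p)
  then show ?case by (cases a) (simp_all add: endpoint_Cons)
qed (simp add: endpoint_def)

lemma finite_dyck_paths: "finite (dyck_paths q)"
proof (rule finite_subset)
  show "dyck_paths q \<subseteq> {p. set p \<subseteq> {North, East} \<and> length p = length q}"
  proof
    fix p assume "p \<in> dyck_paths q"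
    then have "length p = length q"
      by (simp add: length_eq_endpoint dyck_paths_def)
    moreover have "a \<in> {North, East}" for a
      by (cases a) simp_all
    ultimately show "p \<in> {p. set p \<subseteq> {North, East} \<and> length p = length q}"
      by blast
  qed
qed (simp add: finite_lists_length_eq)

lemma no_North_imp_replicate: "North \<notin> set p \<Longrightarrow> p = replicate (length p) East"
  by (rule replicate_eqI) (auto, metis step.exhaust)

lemma endpoint_replicate_East: "endpoint (replicate n East) = (n, 0)"
  by (induction n) (simp_all add: endpoint_def)

lemma dyck_paths_East: "dyck_paths (replicate n East) = {replicate n East}"
proof (intro equalityI subsetI)
  fix p assume "p \<in> dyck_paths (replicate n East)"
  then have p: "endpoint p = (n, 0)"
    by (simp add: dyck_paths_def endpoint_replicate_East)
  then have "North \<notin> set p" "length p = n"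
    by (simp_all add: length_eq_endpoint) (simp add: endpoint_def count_list_0_iff)
  then show "p \<in> {replicate n East}"
    using no_North_imp_replicate by blast
qed (auto simp: dyck_paths_def weakly_above_def)

lemma endpoint_append: "endpoint (p @ q) =
    (fst (endpoint p) + fst (endpoint q), snd (endpoint p) + snd (endpoint q))"
  by (simp add: endpoint_def)

lemma first_North_in_dyck_paths:
  "replicate r East @ North # p \<in> dyck_paths (replicate n East @ North # q) \<longleftrightarrow>
    r \<le> n \<and> p \<in> dyck_paths (replicate (n - r) East @ q)"
  by (auto simp: dyck_paths_def weakly_above_first_North endpoint_append endpoint_Cons
      endpoint_replicate_East prod_eq_iff)

text \<open>The index \<open>c\<close> counts the East steps of the initial run of the lower path
  that remain after the first row is deleted.\<close>

lemma dyck_paths_first_North: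
  "dyck_paths (replicate n East @ North # q) =
    (\<lambda>(c, p). replicate (n - c) East @ North # p) `
      (SIGMA c:{..n}. dyck_paths (replicate c East @ q))"
proof (intro equalityI subsetI)
  fix p assume p: "p \<in> dyck_paths (replicate n East @ North # q)"
  then have "count_list p North \<noteq> 0"
    by (simp add: dyck_paths_def endpoint_def)
  then have "North \<in> set p" by (simp add: count_list_0_iff)
  then obtain ys zs where "p = ys @ North # zs" "North \<notin> set ys"
    by (meson split_list_first)
  then have eq: "p = replicate (length ys) East @ North # zs"
    using no_North_imp_replicate by metis
  then have "length ys \<le> n" "zs \<in> dyck_paths (replicate (n - length ys) East @ q)"
    using p first_North_in_dyck_paths by metis+
  then show "p \<in> (\<lambda>(c, p). replicate (n - c) East @ North # p) `
      (SIGMA c:{..n}. dyck_paths (replicate c East @ q))"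
    by (intro image_eqI[of _ _ "(n - length ys, zs)"]) (simp_all add: eq)
qed (auto simp: first_North_in_dyck_paths)

lemma first_North_eq_iff:
  "replicate r East @ North # p = replicate r' East @ North # p' \<longleftrightarrow> r = r' \<and> p = p'"
proof (induction r arbitrary: r')
  case 0
  then show ?case by (cases r') auto
next
  case (Suc r)
  then show ?case by (cases r') auto
qed

definition path_sum :: "'a::comm_ring_1 \<Rightarrow> path \<Rightarrow> 'a" where
  "path_sum x q = (\<Sum>p\<in>dyck_paths q. x ^ num_valleys p)"

lemma path_sum_East: "path_sum x (replicate n East) = 1"
proof -
  have "num_valleys (replicate n East) = 0"
  proof (induction n)
    case (Suc n)
    then show ?case by (cases n) (simp_all add: num_valleys_Cons)
  qed simp
  then show ?thesis by (simp add: path_sum_def dyck_paths_East)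
qed

text \<open>For \<open>c = n\<close> the upper path begins with North and loses no valley; otherwise
  it loses exactly one.\<close>

lemma path_sum_first_North:
  fixes x :: "'a::comm_ring_1"
  shows "path_sum x (replicate n East @ North # q) =
    (\<Sum>c\<le>n. (if c = n then 1 else x) * path_sum x (replicate c East @ q))"
proof -
  let ?f = "\<lambda>(c, p). replicate (n - c) East @ North # p"
  let ?X = "SIGMA c:{..n}. dyck_paths (replicate c East @ q)"
  have "inj_on ?f ?X"
    by (rule inj_onI) (auto simp: first_North_eq_iff)
  then have "path_sum x (replicate n East @ North # q) = (\<Sum>z\<in>?X. x ^ num_valleys (?f z))"
    by (simp add: path_sum_def dyck_paths_first_North sum.reindex)
  also have "\<dots> = (\<Sum>c\<le>n. \<Sum>p\<in>dyck_paths (replicate c East @ q).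
      x ^ num_valleys (replicate (n - c) East @ North # p))"
    by (subst sum.Sigma) (auto simp: finite_dyck_paths case_prod_unfold)
  also have "\<dots> = (\<Sum>c\<le>n. (if c = n then 1 else x) * path_sum x (replicate c East @ q))"
    by (intro sum.cong refl)
      (auto simp: num_valleys_first_North path_sum_def sum_distrib_left)
  finally show ?thesis .
qed

section \<open>The lattice path of a pair of sets\<close>

definition step_of :: "node \<Rightarrow> step" where
  "step_of v = (case v of Plain i \<Rightarrow> East | Barred j \<Rightarrow> North)"

lemma finite_nodes [simp]: "finite I \<Longrightarrow> finite J \<Longrightarrow> finite (nodes I J)"
  by (simp add: nodes_def)

lemma card_nodes:
  assumes "finite I" "finite J"
  shows "card (nodes I J) = card I + card J"
proof -
  have "Plain ` I \<inter> Barred ` J = {}" by auto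
  moreover have "inj_on Plain I" "inj_on Barred J" by (auto simp: inj_on_def)
  ultimately show ?thesis
    using assms by (simp add: nodes_def card_Un_disjoint card_image)
qed

text \<open>The index range of \<open>nu\<close> skips the first and the last entry of the sorted
  list.\<close>

lemma nu_eq_map:
  assumes "finite I" "finite J"
  shows "nu I J = map step_of (butlast (tl (sorted_list_of_set (nodes I J))))"
proof (rule nth_equalityI)
  let ?L = "sorted_list_of_set (nodes I J)"
  have len: "length ?L = card I + card J"
    using assms by (simp add: card_nodes)
  then show "length (nu I J) = length (map step_of (butlast (tl ?L)))"
    by (simp add: nu_def)
  fix k assume "k < length (nu I J)"
  then have k: "Suc k < card I + card J - 1" by (simp add: nu_def)
  then have "?L ! Suc k \<in> nodes I J"
    using assms len by (metis finite_nodes less_imp_diff_less nth_mem set_sorted_list_of_set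
        less_diff_conv add_lessD1)
  then have "(if ?L ! Suc k \<in> Plain ` I then East else North) = step_of (?L ! Suc k)"
    by (auto simp: nodes_def step_of_def)
  then show "nu I J ! k = map step_of (butlast (tl ?L)) ! k"
    using k len by (simp add: nu_def nth_butlast nth_tl)
qed

lemma sorted_list_of_set_Un_less:
  fixes A B :: "'a::linorder set"
  assumes "finite A" "finite B" "\<And>a b. a \<in> A \<Longrightarrow> b \<in> B \<Longrightarrow> a < b"
  shows "sorted_list_of_set (A \<union> B) = sorted_list_of_set A @ sorted_list_of_set B"
proof (rule sorted_distinct_set_unique)
  show "sorted (sorted_list_of_set A @ sorted_list_of_set B)"
    using assms by (auto simp: sorted_append less_imp_le)
  show "distinct (sorted_list_of_set A @ sorted_list_of_set B)"
    using assms by fastforce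
qed (use assms in simp_all)

lemma map_step_of_Plain:
  assumes "finite A"
  shows "map step_of (sorted_list_of_set (Plain ` A)) = replicate (card A) East"
proof (rule replicate_eqI)
  show "length (map step_of (sorted_list_of_set (Plain ` A))) = card A"
    using assms by (simp add: card_image inj_on_def)
qed (use assms in \<open>auto simp: step_of_def\<close>)

text \<open>Nonemptiness makes \<open>tl\<close> act on the plain block \<open>A\<close> and
  \<open>butlast\<close> on the rest \<open>R\<close>; hence the block yields one East step fewer
  than it has nodes.\<close>

lemma nu_prefix:
  assumes "finite I" "finite J" "finite A" "A \<noteq> {}" "R \<noteq> {}" "finite R"
    and "nodes I J = Plain ` A \<union> R" "\<And>a b. a \<in> A \<Longrightarrow> b \<in> R \<Longrightarrow> Plain a < b"
  shows "nu I J =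
    replicate (card A - 1) East @ map step_of (butlast (sorted_list_of_set R))"
proof -
  let ?A = "sorted_list_of_set (Plain ` A)" and ?R = "sorted_list_of_set R"
  have ne: "?A \<noteq> []" "?R \<noteq> []"
    using assms(3-6) by auto
  have "sorted_list_of_set (nodes I J) = ?A @ ?R"
    unfolding assms(7) using assms(3,6,8) by (intro sorted_list_of_set_Un_less) auto
  then have "nu I J = map step_of (tl ?A) @ map step_of (butlast ?R)"
    using ne by (simp add: nu_eq_map[OF assms(1,2)] butlast_append)
  also have "map step_of (tl ?A) = replicate (card A - 1) East"
    using map_step_of_Plain[OF assms(3)] by (simp add: map_tl)
  finally show ?thesis .
qed

lemma node_less_iffs:
  "Plain i < Barred j \<longleftrightarrow> i \<le> j"
  "Barred j < Plain i \<longleftrightarrow> j < i"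
  "Plain i < Plain i' \<longleftrightarrow> i < i'"
  "Barred j < Barred j' \<longleftrightarrow> j < j'"
  by (auto simp: less_node_def)

text \<open>Removing \<open>{s<..j}\<close> changes only nodes before \<open>Barred j\<close>. The
  steps \<open>w\<close> coming from the later nodes are therefore the same for every
  \<open>s\<close>, which the \<open>obtains\<close> form records.\<close>

lemma nu_insert:
  assumes adm: "admissible I (insert j J)" and less: "\<forall>k\<in>J. j < k" and ne: "J \<noteq> {}"
  obtains w where
    "nu I (insert j J) = replicate (card (I \<inter> {..j}) - 1) East @ North # w"
    "\<And>s. s \<in> I \<Longrightarrow> s \<le> j \<Longrightarrow>
      nu (I - {s<..j}) J = replicate (card (I \<inter> {..s}) - 1) East @ w"
proof -
  have fin: "finite I" "finite J" using adm by (auto simp: admissible_def)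
  let ?R = "nodes (I \<inter> {j<..}) J"
  let ?w = "map step_of (butlast (sorted_list_of_set ?R))"
  have R: "finite ?R" "?R \<noteq> {}"
    using fin ne by (auto simp: nodes_def)
  have "sorted_list_of_set ({Barred j} \<union> ?R) = sorted_list_of_set {Barred j} @ sorted_list_of_set ?R"
    using R less
    by (intro sorted_list_of_set_Un_less) (auto simp: nodes_def node_less_iffs)
  moreover have "sorted_list_of_set ?R \<noteq> []"
    using R by simp
  ultimately have w: "map step_of (butlast (sorted_list_of_set ({Barred j} \<union> ?R))) = North # ?w"
    by (simp add: step_of_def)
  have "I \<inter> {..j} \<noteq> {}"
    using adm by (auto simp: admissible_def)
  moreover have "nodes I (insert j J) = Plain ` (I \<inter> {..j}) \<union> ({Barred j} \<union> ?R)"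
    by (auto simp: nodes_def image_iff not_le)
  moreover have "Plain a < b" if "a \<in> I \<inter> {..j}" "b \<in> {Barred j} \<union> ?R" for a b
    using that less by (auto simp: nodes_def node_less_iffs)
  ultimately have nu1: "nu I (insert j J) = replicate (card (I \<inter> {..j}) - 1) East @ North # ?w"
    unfolding w[symmetric] using fin R by (intro nu_prefix) auto
  have nu2: "nu (I - {s<..j}) J = replicate (card (I \<inter> {..s}) - 1) East @ ?w"
    if s: "s \<in> I" "s \<le> j" for s
  proof -
    have "nodes (I - {s<..j}) J = Plain ` (I \<inter> {..s}) \<union> ?R"
      using s by (auto simp: nodes_def)
    moreover have "Plain a < b" if "a \<in> I \<inter> {..s}" "b \<in> ?R" for a b
      using that s less by (auto simp: nodes_def node_less_iffs)
    moreover have "I \<inter> {..s} \<noteq> {}"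
      using s by auto
    ultimately show ?thesis
      using fin R by (intro nu_prefix) auto
  qed
  show thesis
    by (rule that[OF nu1 nu2])
qed

lemma nu_singleton:
  assumes "admissible I {j}"
  shows "nu I {j} = replicate (card I - 1) East"
proof -
  have "nu I {j} = replicate (card I - 1) East @ map step_of (butlast (sorted_list_of_set {Barred j}))"
    using assms by (intro nu_prefix) (auto simp: admissible_def nodes_def node_less_iffs)
  then show ?thesis by simp
qed

text \<open>Translates the choice of \<open>s\<close> into the number \<open>c\<close> of remaining
  East steps. The rank is strictly increasing, hence injective, and a count gives
  surjectivity.\<close>

lemma bij_betw_rank:
  fixes A :: "nat set"
  assumes "finite A" "A \<noteq> {}"
  shows "bij_betw (\<lambda>s. card (A \<inter> {..s}) - 1) A {..card A - 1}"
proof -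
  let ?r = "\<lambda>s. card (A \<inter> {..s}) - 1"
  have pos: "card (A \<inter> {..s}) > 0" if "s \<in> A" for s
    using that assms by (auto simp: card_gt_0_iff)
  have mono: "?r s < ?r t" if "s \<in> A" "t \<in> A" "s < t" for s t
  proof -
    have "t \<in> A \<inter> {..t}" "t \<notin> A \<inter> {..s}" using that by auto
    then have "A \<inter> {..s} \<subset> A \<inter> {..t}" using that by fastforce
    then have "card (A \<inter> {..s}) < card (A \<inter> {..t})"
      using assms(1) by (intro psubset_card_mono) auto
    then show ?thesis using pos[OF that(1)] by linarith
  qed
  have inj: "inj_on ?r A"
    by (rule inj_onI) (metis mono less_irrefl nat_neq_iff)
  have "?r ` A \<subseteq> {..card A - 1}"
    using assms(1) by (auto intro!: diff_le_mono card_mono)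
  moreover have "card (?r ` A) = card {..card A - 1}"
    using inj assms by (simp add: card_image card_gt_0_iff Suc_pred)
  ultimately have "?r ` A = {..card A - 1}"
    by (intro card_subset_eq) auto
  then show ?thesis
    using inj by (simp add: bij_betw_def)
qed

lemma path_sum_nu_insert:
  fixes x :: "'a::comm_ring_1"
  assumes adm: "admissible I (insert j J)" and less: "\<forall>k\<in>J. j < k" and ne: "J \<noteq> {}"
  shows "path_sum x (nu I (insert j J)) =
    (\<Sum>s\<in>I \<inter> {..j}. (if s = Max (I \<inter> {..j}) then 1 else x) * path_sum x (nu (I - {s<..j}) J))"
proof -
  obtain w where w: "nu I (insert j J) = replicate (card (I \<inter> {..j}) - 1) East @ North # w"
    "\<And>s. s \<in> I \<Longrightarrow> s \<le> j \<Longrightarrow>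
      nu (I - {s<..j}) J = replicate (card (I \<inter> {..s}) - 1) East @ w"
    using nu_insert[OF assms] by blast
  let ?A = "I \<inter> {..j}"
  let ?r = "\<lambda>s. card (?A \<inter> {..s}) - 1"
  have A: "finite ?A" "?A \<noteq> {}"
    using adm by (auto simp: admissible_def)
  note bij = bij_betw_rank[OF A]
  have m: "Max ?A \<in> ?A" using A by (rule Max_in)
  have "?A \<inter> {..Max ?A} = ?A"
    using A by auto
  then have rm: "?r (Max ?A) = card ?A - 1" by simp
  have "path_sum x (nu I (insert j J)) = (\<Sum>c\<le>card ?A - 1.
      (if c = card ?A - 1 then 1 else x) * path_sum x (replicate c East @ w))"
    unfolding w(1) by (rule path_sum_first_North)
  also have "\<dots> = (\<Sum>s\<in>?A.
      (if ?r s = card ?A - 1 then 1 else x) * path_sum x (replicate (?r s) East @ w))"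
    by (rule sum.reindex_bij_betw[OF bij, symmetric])
  also have "\<dots> = (\<Sum>s\<in>?A. (if s = Max ?A then 1 else x) * path_sum x (nu (I - {s<..j}) J))"
  proof (rule sum.cong[OF refl])
    fix s assume s: "s \<in> ?A"
    \<comment> \<open>Only the maximum has the top rank, by injectivity, so the weight
      \<open>1\<close> sits at the same term in both indexings.\<close>
    have "?r s = card ?A - 1 \<longleftrightarrow> s = Max ?A"
      using inj_onD[OF bij_betw_imp_inj_on[OF bij], of s "Max ?A"] rm s m by metis
    moreover have "?A \<inter> {..s} = I \<inter> {..s}"
      using s by auto
    ultimately show "(if ?r s = card ?A - 1 then 1 else x) * path_sum x (replicate (?r s) East @ w) =
        (if s = Max ?A then 1 else x) * path_sum x (nu (I - {s<..j}) J)"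
      using w(2)[of s] s by simp
  qed
  finally show ?thesis .
qed

section \<open>Comparison of the three recursions\<close>

text \<open>The set \<open>I\<close> is generalised because each step of the recursion deletes plain
  nodes from it.\<close>

lemma sums_eq:
  fixes x :: "'a::comm_ring_1"
  assumes "finite J" "admissible I J"
  shows "face_sum x I J = tree_sum x I J \<and> face_sum x I J = path_sum x (nu I J)"
  using assms
proof (induction J arbitrary: I rule: finite_linorder_min_induct)
  case empty
  then show ?case by (simp add: admissible_def)
next
  case (insert j J)
  show ?case
  proof (cases "J = {}")
    case True
    then show ?thesis
      using insert.prems
      by (simp add: face_sum_singleton tree_sum_singleton nu_singleton path_sum_East)
  next
    case False
    have IH: "tree_sum x (I - {s<..j}) J = face_sum x (I - {s<..j}) J"
      "path_sum x (nu (I - {s<..j}) J) = face_sum x (I - {s<..j}) J"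
      if "s \<in> I \<inter> {..j}" for s
      using insert.IH[OF admissible_Diff[OF insert.prems False insert.hyps(2)], of s] that
      by auto
    show ?thesis
      unfolding face_sum_insert[OF insert.prems insert.hyps(2) False]
        tree_sum_insert[OF insert.prems insert.hyps(2) False]
        path_sum_nu_insert[OF insert.prems insert.hyps(2) False]
      by (simp only: IH cong: sum.cong)
  qed
qed

section \<open>From generating polynomials to the h-vector\<close>

text \<open>Ungroups the faces that \<open>num_faces\<close> collects by size, giving the shape of
  \<open>face_sum\<close> with the polynomial variable for \<open>x\<close>.\<close>

lemma h_poly_eq_sum:
  fixes K :: "'a set set"
  assumes "finite K"
  shows "h_poly K =
    (\<Sum>\<sigma>\<in>K. [:0, 1:] ^ card \<sigma> * (1 - [:0, 1:]) ^ (Max (card ` K) - card \<sigma>))"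
proof -
  let ?d = "Max (card ` K)"
  let ?t = "\<lambda>i. [:0, 1:] ^ i * (1 - [:0, 1:]) ^ (?d - i) :: int poly"
  have X: "[:1, -1:] = 1 - ([:0, 1:] :: int poly)" by (simp add: one_pCons)
  have "card ` K \<subseteq> {..?d}"
    using assms by auto
  then have "(\<Sum>\<sigma>\<in>K. ?t (card \<sigma>)) = (\<Sum>i\<le>?d. \<Sum>\<sigma> | \<sigma> \<in> K \<and> card \<sigma> = i. ?t (card \<sigma>))"
    using assms by (intro sum.group[symmetric]) auto
  also have "\<dots> = (\<Sum>i\<le>?d. of_nat (num_faces K i) * ?t i)"
    by (intro sum.cong refl) (simp add: num_faces_def)
  finally show ?thesis
    unfolding h_poly_def X by (simp add: Let_def mult.assoc)
qed

lemma coeff_sum_power_X: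
  assumes "finite A"
  shows "coeff (\<Sum>a\<in>A. [:0, 1 :: int:] ^ f a) l = int (card {a \<in> A. f a = l})"
proof -
  have "[:0, 1 :: int:] ^ n = monom 1 n" for n
    by (simp add: monom_altdef)
  then have "coeff (\<Sum>a\<in>A. [:0, 1 :: int:] ^ f a) l = (\<Sum>a\<in>A. if f a = l then 1 else 0)"
    by (simp add: coeff_sum)
  also have "\<dots> = int (card {a \<in> A. f a = l})"
    using assms by (simp add: sum.If_cases Int_def)
  finally show ?thesis .
qed

text \<open>Compare every barred node with the least node and every plain node with the greatest
  one.\<close>

lemma admissible_if_nodes:
  assumes "finite I" "finite J" "I \<noteq> {}" "J \<noteq> {}"
    and "Min (nodes I J) \<in> Plain ` I" "Max (nodes I J) \<in> Barred ` J"
  shows "admissible I J"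
proof -
  obtain i where i: "i \<in> I" "Min (nodes I J) = Plain i"
    using assms(5) by blast
  obtain j where j: "j \<in> J" "Max (nodes I J) = Barred j"
    using assms(6) by blast
  have "i \<le> k" if "k \<in> J" for k
    using Min_le[of "nodes I J" "Barred k"] that assms(1,2) unfolding i(2)
    by (simp add: nodes_def)
  moreover have "k \<le> j" if "k \<in> I" for k
    using Max_ge[of "nodes I J" "Plain k"] that assms(1,2) unfolding j(2)
    by (simp add: nodes_def)
  ultimately show ?thesis
    using assms(1-4) i(1) j(1) by (auto simp: admissible_def)
qed

text \<open>\<open>Barred\<close> is monotone and injective, so it preserves the maximum and the
  count; the degree of a barred node is the number of its plain neighbours.\<close>

lemma card_nonleaf_nodes:
  assumes "finite J" "J \<noteq> {}"
  shows "card {v \<in> Barred ` J - {Max (Barred ` J)}. \<not> is_leaf T v} = nonleaves J T"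
proof -
  have "mono Barred" by (auto simp: mono_def)
  then have Max: "Max (Barred ` J) = Barred (Max J)"
    using mono_Max_commute[of Barred J] assms by simp
  have "degree_of T (Barred j) = card {i. (i, j) \<in> T}" for j
  proof -
    have "{(i, j'). (i, j') \<in> T \<and> (Barred j = Plain i \<or> Barred j = Barred j')} =
        (\<lambda>i. (i, j)) ` {i. (i, j) \<in> T}"
      by auto
    then show ?thesis
      by (simp add: degree_of_def card_image inj_on_def)
  qed
  then have "{v \<in> Barred ` J - {Max (Barred ` J)}. \<not> is_leaf T v} =
      Barred ` {j \<in> J - {Max J}. card {i. (i, j) \<in> T} \<noteq> 1}"
    unfolding Max is_leaf_def by auto
  then show ?thesis
    by (simp add: nonleaves_def card_image inj_on_def)
qed

theorem theorem4p6:
  fixes I J :: "nat set" and l :: nat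
  assumes "finite I" and "I \<noteq> {}"
    and "finite J" and "J \<noteq> {}"
    and "Min (nodes I J) \<in> Plain ` I"
    and "Max (nodes I J) \<in> Barred ` J"
  shows "h_vector (tamari_complex I J) l =
           int (card {T. is_tree I J T \<and>
             card {v \<in> Barred ` J - {Max (Barred ` J)}. \<not> is_leaf T v} = l})
       \<and> h_vector (tamari_complex I J) l =
           int (card {p \<in> dyck_paths (nu I J). num_valleys p = l})"
proof -
  \<comment> \<open>The identities hold in every commutative ring; at the polynomial variable they
    can be compared coefficientwise.\<close>
  let ?X = "[:0, 1:] :: int poly"
  have adm: "admissible I J"
    using admissible_if_nodes assms by blast
  have fin: "finite (tamari_complex I J)"
    using assms by (simp add: tamari_complex_def finite_is_forest)
  have h: "h_vector (tamari_complex I J) l = coeff (face_sum ?X I J) l"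
    unfolding h_vector_def h_poly_eq_sum[OF fin] Max_card_tamari_complex[OF adm] face_sum_def
    by (simp add: tamari_complex_def)
  have eq: "face_sum ?X I J = tree_sum ?X I J" "face_sum ?X I J = path_sum ?X (nu I J)"
    using sums_eq[OF assms(3) adm] by blast+
  have finT: "finite {T. is_tree I J T}"
    using fin by (rule rev_finite_subset) (auto simp: is_tree_def tamari_complex_def)
  \<comment> \<open>Purity turns the size filter of \<open>tree_sum\<close> back into
    maximality.\<close>
  have trees: "{F \<in> {F. is_forest I J F}. card F = card I + card J - 1} = {T. is_tree I J T}"
    by (simp add: is_tree_iff_card[OF adm])
  have "tree_sum ?X I J = (\<Sum>T | is_tree I J T. ?X ^ nonleaves J T)"
    unfolding tree_sum_def trees[symmetric] using assms
    by (intro sum.inter_filter[symmetric] finite_is_forest) auto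
  then have "h_vector (tamari_complex I J) l = int (card {T \<in> {T. is_tree I J T}. nonleaves J T = l})"
    unfolding h eq(1) by (simp only: coeff_sum_power_X[OF finT])
  moreover have "h_vector (tamari_complex I J) l =
      int (card {p \<in> dyck_paths (nu I J). num_valleys p = l})"
    unfolding h eq(2) path_sum_def by (rule coeff_sum_power_X[OF finite_dyck_paths])
  ultimately show ?thesis
    unfolding card_nonleaf_nodes[OF assms(3,4)] by simp
qed

end
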